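(* Let $Q \subset \mathbb{R}^M$ be a measurable set with $|Q|<\infty$, and let $U_n : Q\to\mathbb{R}^D$, $n = 1,2,\dots$, be a sequence of measurable functions that is weakly asymptotically stationary. Then $\{U_n\}_{n=1}^\infty$ is weakly (S)-convergent; in particular, for every $b \in C_c(\mathbb{R}^D)$ there is a function $\overline{b(U)}$ such that $$\frac1N\sum_{n=1}^N b(U_n) \to \overline{b(U)} \quad\text{in } L^1(Q) \text{ as } N\to\infty.$$
   Context: Weak asymptotic stationarity: $\{U_n\}$ is weakly asymptotically stationary if for every $b\in C_c(\mathbb{R}^D)$: - for every fixed $m$ the limit $\lim_{N\to\infty}\frac1N\sum_{n=1}^N\int_Q b(U_n)b(U_m)\,dy$ exists; and - there is a function $k\mapsto \omega(b,k)$ with $\omega(b,k)\to0$ as $k\to\infty$ such that $$\Big|\int_Q \big[ b(U_{k_1})b(U_{k_2}) - b(U_{k_1+n})b(U_{k_2+n})\big]dy\Big| \le \omega(b,k)$$ for all $1\le k\le k_1\le k_2$ and all $n\ge0$. Weak (S)-convergence: $\{U_n\}$ is weakly (S)-convergent if for every $b \in C_c(\mathbb{R}^D)$: (a) for every fixed $m$ the limit $\lim_{N\to\infty} \frac1N \sum_{n=1}^N \int_Q b(U_n) b(U_m)\,dy$ exists; and (b) the following limits exist and $$\lim_{N\to\infty} \frac1{N^2}\sum_{n,m=1}^N \int_Q b(U_n)b(U_m)\,dy = \lim_{M\to\infty} \frac1M \sum_{m=1}^M \Big[ \lim_{N\to\infty} \frac1N \sum_{n=1}^N \int_Q b(U_n)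 b(U_m)\,dy \Big].$$ *)

theory Defs
  imports "HOL-Analysis.Analysis"
begin

definition Cc :: "('a::topological_space \<Rightarrow> real) set" where
  "Cc = {b. continuous_on UNIV b \<and> compact (closure {x. b x \<noteq> 0})}"

definition corr ::
    "(real^'m) set \<Rightarrow> (real^'d \<Rightarrow> real) \<Rightarrow> (nat \<Rightarrow> real^'m \<Rightarrow> real^'d) \<Rightarrow> nat \<Rightarrow> nat \<Rightarrow> real" where
  "corr Q b U n m = (LINT y|lebesgue_on Q. b (U n y) * b (U m y))"

text \<open>Sequences are indexed by 1, 2, ...; the value \<open>U 0\<close> is never used.\<close>

definition weakly_asymptotically_stationary ::
    "(real^'m) set \<Rightarrow> (nat \<Rightarrow> real^'m \<Rightarrow> real^'d) \<Rightarrow> bool" where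
  "weakly_asymptotically_stationary Q U \<longleftrightarrow> (\<forall>b\<in>Cc.
     (\<forall>m\<ge>1. convergent (\<lambda>N. (1 / real N) * (\<Sum>n=1..N. corr Q b U n m))) \<and>
     (\<exists>\<omega> :: nat \<Rightarrow> real. \<omega> \<longlonglongrightarrow> 0 \<and>
        (\<forall>k k\<^sub>1 k\<^sub>2 n. 1 \<le> k \<and> k \<le> k\<^sub>1 \<and> k\<^sub>1 \<le> k\<^sub>2 \<longrightarrow>
           \<bar>LINT y|lebesgue_on Q. b (U k\<^sub>1 y) * b (U k\<^sub>2 y)
               - b (U (k\<^sub>1 + n) y) * b (U (k\<^sub>2 + n) y)\<bar> \<le> \<omega> k)))"

definition weakly_S_convergent ::
    "(real^'m) set \<Rightarrow> (nat \<Rightarrow> real^'m \<Rightarrow> real^'d) \<Rightarrow> bool" where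
  "weakly_S_convergent Q U \<longleftrightarrow> (\<forall>b\<in>Cc.
     (\<forall>m\<ge>1. convergent (\<lambda>N. (1 / real N) * (\<Sum>n=1..N. corr Q b U n m))) \<and>
     convergent (\<lambda>N. (1 / (real N)\<^sup>2) * (\<Sum>n=1..N. \<Sum>m=1..N. corr Q b U n m)) \<and>
     convergent (\<lambda>M. (1 / real M) *
       (\<Sum>m=1..M. lim (\<lambda>N. (1 / real N) * (\<Sum>n=1..N. corr Q b U n m)))) \<and>
     lim (\<lambda>N. (1 / (real N)\<^sup>2) * (\<Sum>n=1..N. \<Sum>m=1..N. corr Q b U n m)) =
     lim (\<lambda>M. (1 / real M) *
       (\<Sum>m=1..M. lim (\<lambda>N. (1 / real N) * (\<Sum>n=1..N. corr Q b U n m)))))"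

text \<open>Integrability is part of the definition because the Bochner integral of a non-integrable
  function is 0.\<close>

definition tendsto_in_L1 :: "'a measure \<Rightarrow> (nat \<Rightarrow> 'a \<Rightarrow> real) \<Rightarrow> ('a \<Rightarrow> real) \<Rightarrow> bool" where
  "tendsto_in_L1 M f g \<longleftrightarrow> (\<forall>n. integrable M (f n)) \<and> integrable M g \<and>
     (\<lambda>n. LINT y|M. \<bar>f n y - g y\<bar>) \<longlonglongrightarrow> 0"

end

theory Submission
  imports Defs "HOL-Real_Asymp.Real_Asymp"
begin

text \<open>
  Fix \<open>b\<close> and put \<open>c n m = \<integral> b(U\<^sub>n) b(U\<^sub>m)\<close>. Stationarity makes the sequences
  \<open>j \<mapsto> c k (k + j)\<close> uniformly Cauchy in \<open>k\<close>, so the row limits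
  \<open>L k = lim\<^sub>N (1/N) (c 1 k + \<dots> + c N k)\<close> satisfy \<open>\<bar>L k - L l\<bar> \<le> \<omega> k\<close> for \<open>k \<le> l\<close> and converge
  to some \<open>R\<close>. Read backwards, the column \<open>c 1 s, \<dots>, c s s\<close> is up to \<open>\<omega> k\<close> and boundary terms an initial
  segment of \<open>j \<mapsto> c k (k + j)\<close>, so its mean tends to \<open>R\<close> as well; summing by columns, so does the double
  mean. For the averages \<open>S\<^sub>N\<close> of \<open>b(U\<^sub>n)\<close> this gives
  \<open>lim\<^sub>N \<parallel>S\<^sub>N - S\<^sub>M\<parallel>\<^sup>2 = R - (2/M) (L 1 + \<dots> + L M) + \<parallel>S\<^sub>M\<parallel>\<^sup>2\<close> in \<open>L\<^sup>2\<close>, which tends to \<open>0\<close> as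
  \<open>M\<close> grows. Hence \<open>S\<^sub>N\<close> is Cauchy in \<open>L\<^sup>1\<close>, which is complete.
\<close>

section \<open>Cesaro means and linearly weighted means of real sequences\<close>

lemma cesaro_mean_tendsto:
  fixes x :: "nat \<Rightarrow> real"
  assumes "x \<longlonglongrightarrow> l"
  shows "(\<lambda>N. (\<Sum>n=1..N. x n) / real N) \<longlonglongrightarrow> l"
proof (rule LIMSEQ_I)
  fix e :: real assume "e > 0"
  then obtain n0 where n0: "\<And>n. n \<ge> n0 \<Longrightarrow> \<bar>x n - l\<bar> < e / 2"
    using LIMSEQ_D[OF assms, of "e / 2"] by auto
  \<comment> \<open>The deviations up to the threshold form a constant, so their share of the mean
    is \<open>C / real N\<close> and vanishes.\<close>
  define C where "C = (\<Sum>n=1..n0. \<bar>x n - l\<bar>)"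
  have "(\<lambda>N. C / real N) \<longlonglongrightarrow> 0"
    by real_asymp
  then obtain n1 where n1: "\<And>N. N \<ge> n1 \<Longrightarrow> \<bar>C / real N\<bar> < e / 2"
    using LIMSEQ_D[of "\<lambda>N. C / real N" 0 "e / 2"] \<open>e > 0\<close> by auto
  have "\<bar>(\<Sum>n=1..N. x n) / real N - l\<bar> < e" if N: "N \<ge> max 1 n1" for N
  proof -
    have "\<bar>\<Sum>n=1..N. x n - l\<bar> \<le> (\<Sum>n=1..N. \<bar>x n - l\<bar>)"
      by (rule sum_abs)
    also have "\<dots> \<le> (\<Sum>n=1..N. (if n \<le> n0 then \<bar>x n - l\<bar> else 0) + e / 2)"
      using n0 \<open>e > 0\<close> by (intro sum_mono) (auto simp: less_imp_le)
    also have "\<dots> = (\<Sum>n | n \<in> {1..N} \<and> n \<le> n0. \<bar>x n - l\<bar>) + real N * (e / 2)"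
      by (simp only: sum.distrib sum_constant card_atLeastAtMost sum.inter_filter[OF finite_atLeastAtMost]) simp
    also have "(\<Sum>n | n \<in> {1..N} \<and> n \<le> n0. \<bar>x n - l\<bar>) \<le> C"
      unfolding C_def by (intro sum_mono2) auto
    finally have le: "\<bar>\<Sum>n=1..N. x n - l\<bar> / real N \<le> C / real N + e / 2"
      using N by (simp add: field_simps)
    have eq: "(\<Sum>n=1..N. x n) / real N - l = (\<Sum>n=1..N. x n - l) / real N"
      using N by (simp add: sum_subtractf field_simps)
    have "C / real N < e / 2"
      using N by (intro le_less_trans[OF abs_ge_self n1]) simp
    then show ?thesis
      unfolding eq abs_divide abs_of_nat using le by linarith
  qed
  then show "\<exists>no. \<forall>N\<ge>no. norm ((\<Sum>n=1..N. x n) / real N - l) < e"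
    unfolding real_norm_def by blast
qed

text \<open>The weights \<open>2 * real s\<close> sum to N^2 + N, so after division by N^2 their
  total tends to 1, while any fixed finite set of them has a share tending to 0. The corrections
  \<open>y s\<close> add up to at most \<open>real N * K\<close> and disappear.
  \<open>double_sum_eq\<close> brings double sums into this shape.\<close>

lemma linearly_weighted_mean_tendsto:
  fixes x y :: "nat \<Rightarrow> real"
  assumes x: "x \<longlonglongrightarrow> l" and y: "\<And>s. s \<ge> 1 \<Longrightarrow> \<bar>y s\<bar> \<le> K"
  shows "(\<lambda>N. (\<Sum>s=1..N. 2 * real s * x s - y s) / (real N)\<^sup>2) \<longlonglongrightarrow> l"
proof -
  \<comment> \<open>Estimating each weight by \<open>2 * real N\<close> gives the first term; the
    second collects the \<open>y s\<close> and the surplus \<open>l * real N\<close> of the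
    weights.\<close>
  define err where
    "err N = 2 * ((\<Sum>s=1..N. \<bar>x s - l\<bar>) / real N) + (K + \<bar>l\<bar>) / real N" for N
  have "(\<lambda>s. \<bar>x s - l\<bar>) \<longlonglongrightarrow> 0"
    using x by (simp add: LIM_zero tendsto_rabs_zero)
  then have "(\<lambda>N. (\<Sum>s=1..N. \<bar>x s - l\<bar>) / real N) \<longlonglongrightarrow> 0"
    by (rule cesaro_mean_tendsto)
  moreover have "(\<lambda>N. (K + \<bar>l\<bar>) / real N) \<longlonglongrightarrow> 0"
    by real_asymp
  ultimately have "err \<longlonglongrightarrow> 2 * 0 + 0"
    unfolding err_def by (intro tendsto_add tendsto_mult tendsto_const)
  then have err: "err \<longlonglongrightarrow> 0"
    by simp
  have bound: "\<bar>(\<Sum>s=1..N. 2 * real s * x s - y s) / (real N)\<^sup>2 - l\<bar> \<le> err N" if N: "N \<ge> 1" for N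
  proof -
    have "(\<Sum>s=1..N. 2 * real s) = (real N)\<^sup>2 + real N"
      by (induction N) (auto simp: power2_eq_square algebra_simps)
    then have "l * (real N)\<^sup>2 = (\<Sum>s=1..N. 2 * real s * l) - l * real N"
      unfolding sum_distrib_right[symmetric] by (simp add: algebra_simps)
    then have "(\<Sum>s=1..N. 2 * real s * x s - y s) - l * (real N)\<^sup>2
        = (\<Sum>s=1..N. 2 * real s * (x s - l)) - (\<Sum>s=1..N. y s) + l * real N"
      by (simp add: sum_subtractf right_diff_distrib)
    moreover have "\<bar>\<Sum>s=1..N. 2 * real s * (x s - l)\<bar> \<le> (\<Sum>s=1..N. 2 * real N * \<bar>x s - l\<bar>)"
      by (intro order_trans[OF sum_abs] sum_mono) (auto simp: abs_mult intro!: mult_right_mono)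
    moreover have "\<bar>\<Sum>s=1..N. y s\<bar> \<le> real N * K"
      using order_trans[OF sum_abs sum_bounded_above[of "{1..N}" "\<lambda>s. \<bar>y s\<bar>" K]] y by auto
    moreover have "\<bar>l * real N\<bar> = \<bar>l\<bar> * real N"
      by (simp add: abs_mult)
    ultimately have "\<bar>(\<Sum>s=1..N. 2 * real s * x s - y s) - l * (real N)\<^sup>2\<bar>
        \<le> 2 * real N * (\<Sum>s=1..N. \<bar>x s - l\<bar>) + real N * K + \<bar>l\<bar> * real N"
      unfolding sum_distrib_left[symmetric] by linarith
    also have "\<dots> = err N * (real N)\<^sup>2"
      using N by (simp add: err_def field_simps power2_eq_square)
    finally have "\<bar>(\<Sum>s=1..N. 2 * real s * x s - y s) - l * (real N)\<^sup>2\<bar> / (real N)\<^sup>2 \<le> err N"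
      using N by (simp add: pos_divide_le_eq)
    moreover have "(\<Sum>s=1..N. 2 * real s * x s - y s) / (real N)\<^sup>2 - l
        = ((\<Sum>s=1..N. 2 * real s * x s - y s) - l * (real N)\<^sup>2) / (real N)\<^sup>2"
      using N by (simp add: diff_divide_distrib)
    ultimately show ?thesis
      by (simp add: abs_divide)
  qed
  have "(\<lambda>N. (\<Sum>s=1..N. 2 * real s * x s - y s) / (real N)\<^sup>2 - l) \<longlonglongrightarrow> 0"
    by (rule Lim_null_comparison[OF _ err]) (use bound in \<open>auto simp: eventually_sequentially\<close>)
  then show ?thesis
    by (rule LIM_zero_cancel)
qed

section \<open>Symmetric kernels that are asymptotically invariant under diagonal shifts\<close>

text \<open>These properties of \<open>corr Q b U\<close> for a single \<open>b\<close> determine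
  the limits of its means, which can thus be found without measure theory. All but symmetry and
  \<open>modulus\<close> concern positive indices only, since \<open>U 0\<close> is
  arbitrary.\<close>

locale asymptotically_stationary_kernel =
  fixes c :: "nat \<Rightarrow> nat \<Rightarrow> real" and K :: real and L \<omega> :: "nat \<Rightarrow> real"
  assumes sym: "c n m = c m n"
    and bounded: "1 \<le> n \<Longrightarrow> 1 \<le> m \<Longrightarrow> \<bar>c n m\<bar> \<le> K"
    and row_mean: "1 \<le> k \<Longrightarrow> (\<lambda>N. (\<Sum>n=1..N. c n k) / real N) \<longlonglongrightarrow> L k"
    and shift: "1 \<le> k \<Longrightarrow> k \<le> i \<Longrightarrow> i \<le> j \<Longrightarrow> \<bar>c i j - c (i + n) (j + n)\<bar> \<le> \<omega> k"
    and modulus: "\<omega> \<longlonglongrightarrow> 0"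
begin

text \<open>Starting row \<open>k\<close> at its diagonal entry makes the summation index the lag. A
  diagonal shift changes \<open>k\<close> and keeps the lag, so these means can be compared for
  different \<open>k\<close>.\<close>

definition lag_mean :: "nat \<Rightarrow> nat \<Rightarrow> real" where
  "lag_mean k N = (\<Sum>j<N. c k (k + j)) / real N"

text \<open>Column \<open>s\<close> is cut off at the diagonal: there the smaller index comes first,
  as \<open>shift\<close> demands, and by symmetry these parts determine the sums over
  squares.\<close>

definition column_mean :: "nat \<Rightarrow> real" where
  "column_mean s = (\<Sum>m=1..s. c m s) / real s"

lemma K_nonneg: "0 \<le> K"
  using bounded[of 1 1] by linarith

text \<open>Compared with \<open>row_mean\<close>, the first \<open>k - 1\<close> terms are dropped
  and the window is moved by as much, neither of which affects a Cesaro limit.\<close>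

lemma lag_mean_tendsto:
  assumes k: "1 \<le> k"
  shows "lag_mean k \<longlonglongrightarrow> L k"
proof -
  define F where "F N = (\<Sum>n=1..N. c n k)" for N
  \<comment> \<open>\<open>sym\<close> turns the row into the column summed by \<open>F\<close>; the
    offset is \<open>k - 1\<close> because \<open>F\<close> starts at index 1 and the lags start at
    \<open>k\<close>.\<close>
  have F_split: "(\<Sum>j<N. c k (k + j)) = F (N + (k - 1)) - F (k - 1)" for N
  proof (induction N)
    case (Suc N)
    have "F (Suc N + (k - 1)) = F (N + (k - 1)) + c (k + N) k"
      using k by (cases k) (simp_all add: F_def add.commute)
    then show ?case
      using Suc sym[of k "k + N"] by simp
  qed simp
  have "(\<lambda>N. F (N + (k - 1)) / real (N + (k - 1))) \<longlonglongrightarrow> L k"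
    using LIMSEQ_ignore_initial_segment[OF row_mean[OF k], of "k - 1"] by (simp add: F_def)
  moreover have "(\<lambda>N. real (N + (k - 1)) / real N) \<longlonglongrightarrow> 1"
    by real_asymp
  ultimately have "(\<lambda>N. F (N + (k - 1)) / real (N + (k - 1)) * (real (N + (k - 1)) / real N)) \<longlonglongrightarrow> L k"
    using tendsto_mult by fastforce
  moreover have "(\<lambda>N. F (k - 1) / real N) \<longlonglongrightarrow> 0"
    by real_asymp
  ultimately have "(\<lambda>N. F (N + (k - 1)) / real (N + (k - 1)) * (real (N + (k - 1)) / real N)
      - F (k - 1) / real N) \<longlonglongrightarrow> L k"
    using tendsto_diff by fastforce
  moreover have "\<forall>\<^sub>F N in sequentially. F (N + (k - 1)) / real (N + (k - 1)) * (real (N + (k - 1)) / real N)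
      - F (k - 1) / real N = lag_mean k N"
    using eventually_gt_at_top[of 0]
    by eventually_elim (simp add: lag_mean_def F_split diff_divide_distrib)
  ultimately show ?thesis
    by (rule Lim_transform_eventually)
qed

text \<open>The shift by \<open>l - k\<close> carries \<open>c k (k + j)\<close> to
  \<open>c l (l + j)\<close>. The resulting bound is uniform in the lag and survives averaging and
  the limit.\<close>

lemma L_dist:
  assumes k: "1 \<le> k" "k \<le> l"
  shows "\<bar>L k - L l\<bar> \<le> \<omega> k"
proof -
  have "\<bar>lag_mean k N - lag_mean l N\<bar> \<le> \<omega> k" if N: "N \<ge> 1" for N
  proof -
    have "\<bar>c k (k + j) - c l (l + j)\<bar> \<le> \<omega> k" for j
      using shift[of k k "k + j" "l - k"] k by (simp add: add.commute)
    then have "\<bar>\<Sum>j<N. c k (k + j) - c l (l + j)\<bar> \<le> real N * \<omega> k"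
      using order_trans[OF sum_abs
        sum_bounded_above[of "{..<N}" "\<lambda>j. \<bar>c k (k + j) - c l (l + j)\<bar>" "\<omega> k"]] by auto
    moreover have "lag_mean k N - lag_mean l N = (\<Sum>j<N. c k (k + j) - c l (l + j)) / real N"
      by (simp add: lag_mean_def sum_subtractf diff_divide_distrib)
    ultimately show ?thesis
      using N by (simp add: abs_divide pos_divide_le_eq mult.commute)
  qed
  moreover have "(\<lambda>N. \<bar>lag_mean k N - lag_mean l N\<bar>) \<longlonglongrightarrow> \<bar>L k - L l\<bar>"
    using k by (intro tendsto_intros lag_mean_tendsto) auto
  ultimately show ?thesis
    by (intro LIMSEQ_le_const2) auto
qed

text \<open>The entry of column \<open>s\<close> at lag \<open>j\<close> is
  \<open>c (s - j) s\<close>, the image of \<open>c k (k + j)\<close> under the shift by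
  \<open>s - j - k\<close>. This shift is available unless \<open>s < j + k\<close>, which happens
  for at most \<open>k\<close> lags, each costing at most \<open>2 * K\<close>.\<close>

lemma column_mean_dist:
  assumes k: "1 \<le> k" and s: "1 \<le> s"
  shows "\<bar>column_mean s - lag_mean k s\<bar> \<le> \<omega> k + 2 * K * real k / real s"
proof -
  \<comment> \<open>The trivial shift by 0 shows this; it allows \<open>\<omega> k\<close> to be
    charged at every lag, the exceptional ones included.\<close>
  have \<omega>: "0 \<le> \<omega> k"
    using shift[of k k k 0] k by simp
  \<comment> \<open>Reading the column upwards from the diagonal makes the lag the summation
    index.\<close>
  have rev: "(\<Sum>m=1..s. c m s) = (\<Sum>j<s. c (s - j) s)"
  proof -
    have "(\<Sum>m=1..s. c m s) = (\<Sum>i<s. c (Suc i) s)"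
      by (simp add: sum.atLeast1_atMost_eq)
    also have "\<dots> = (\<Sum>i<s. c (Suc (s - Suc i)) s)"
      by (rule sum.nat_diff_reindex[symmetric])
    also have "\<dots> = (\<Sum>j<s. c (s - j) s)"
      by (intro sum.cong) (auto simp: Suc_diff_Suc)
    finally show ?thesis .
  qed
  have "\<bar>c (s - j) s - c k (k + j)\<bar> \<le> \<omega> k + (if s < j + k then 2 * K else 0)" if j: "j < s" for j
  proof (cases "s < j + k")
    case True
    have "\<bar>c (s - j) s\<bar> \<le> K" "\<bar>c k (k + j)\<bar> \<le> K"
      using j k by (auto intro!: bounded)
    then show ?thesis
      using True \<omega> by auto
  next
    case False
    then have "k + (s - j - k) = s - j" "k + j + (s - j - k) = s"
      using j by auto
    then show ?thesis
      using shift[of k k "k + j" "s - j - k"] k False by simp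
  qed
  then have "\<bar>\<Sum>j<s. c (s - j) s - c k (k + j)\<bar> \<le> (\<Sum>j<s. \<omega> k + (if s < j + k then 2 * K else 0))"
    by (intro order_trans[OF sum_abs] sum_mono) auto
  also have "\<dots> = real s * \<omega> k + real (card {j. j < s \<and> s < j + k}) * (2 * K)"
    by (simp add: sum.distrib sum.inter_filter[symmetric])
  also have "card {j. j < s \<and> s < j + k} \<le> card {s - k..<s}"
    by (intro card_mono) auto
  also have "\<dots> \<le> k"
    by simp
  finally have "\<bar>\<Sum>j<s. c (s - j) s - c k (k + j)\<bar> \<le> real s * \<omega> k + real k * (2 * K)"
    using K_nonneg by (simp add: mult_right_mono)
  moreover have "column_mean s - lag_mean k s = (\<Sum>j<s. c (s - j) s - c k (k + j)) / real s"
    unfolding column_mean_def lag_mean_def rev sum_subtractf diff_divide_distrib ..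
  ultimately have "\<bar>column_mean s - lag_mean k s\<bar> \<le> (real s * \<omega> k + real k * (2 * K)) / real s"
    using s by (simp add: abs_divide divide_right_mono)
  also have "\<dots> = \<omega> k + 2 * K * real k / real s"
    using s by (simp add: field_simps)
  finally show ?thesis .
qed

text \<open>Enlarging the square by one adds a row and a column that agree by symmetry and share
  their diagonal entry, which is why \<open>c s s\<close> is subtracted once.\<close>

lemma double_sum_eq:
  "(\<Sum>n=1..N. \<Sum>m=1..N. c n m) = (\<Sum>s=1..N. 2 * real s * column_mean s - c s s)"
proof (induction N)
  case (Suc N)
  have col: "real (Suc N) * column_mean (Suc N) = (\<Sum>m=1..N. c m (Suc N)) + c (Suc N) (Suc N)"
    by (simp add: column_mean_def)
  have "(\<Sum>n=1..Suc N. \<Sum>m=1..Suc N. c n m)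
      = (\<Sum>n=1..N. \<Sum>m=1..N. c n m) + (\<Sum>n=1..N. c n (Suc N))
        + (\<Sum>m=1..N. c (Suc N) m) + c (Suc N) (Suc N)"
    by (simp add: sum.distrib)
  also have "(\<Sum>m=1..N. c (Suc N) m) = (\<Sum>m=1..N. c m (Suc N))"
    by (intro sum.cong sym) auto
  finally have "(\<Sum>n=1..Suc N. \<Sum>m=1..Suc N. c n m)
      = (\<Sum>n=1..N. \<Sum>m=1..N. c n m) + (2 * (\<Sum>m=1..N. c m (Suc N)) + c (Suc N) (Suc N))"
    by simp
  also have "2 * (\<Sum>m=1..N. c m (Suc N)) + c (Suc N) (Suc N)
      = 2 * real (Suc N) * column_mean (Suc N) - c (Suc N) (Suc N)"
    unfolding mult.assoc col by simp
  finally show ?case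
    using Suc by simp
qed simp

text \<open>The column means link the two limits: they inherit \<open>R\<close> from
  \<open>L\<close> through \<open>column_mean_dist\<close>, and the double mean is essentially a
  linearly weighted mean of them.\<close>

lemma double_mean_limit:
  obtains R where "L \<longlonglongrightarrow> R"
    and "(\<lambda>N. (\<Sum>n=1..N. \<Sum>m=1..N. c n m) / (real N)\<^sup>2) \<longlonglongrightarrow> R"
proof -
  have "Cauchy L"
  proof (rule metric_CauchyI)
    fix e :: real assume "e > 0"
    then obtain k0 where k0: "\<And>k. k \<ge> k0 \<Longrightarrow> \<bar>\<omega> k\<bar> < e"
      using LIMSEQ_D[OF modulus, of e] by auto
    have "\<bar>L m - L n\<bar> < e" if "m \<ge> max 1 k0" "n \<ge> max 1 k0" for m n
      using that L_dist[of m n] L_dist[of n m] k0[of m] k0[of n] by (cases "m \<le> n") auto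
    then show "\<exists>M. \<forall>m\<ge>M. \<forall>n\<ge>M. dist (L m) (L n) < e"
      unfolding dist_real_def by blast
  qed
  then obtain R where R: "L \<longlonglongrightarrow> R"
    using Cauchy_convergent convergent_def by blast
  have "column_mean \<longlonglongrightarrow> R"
  proof (rule LIMSEQ_I)
    fix e :: real assume "e > 0"
    have "\<forall>\<^sub>F k in sequentially. \<bar>\<omega> k\<bar> < e / 4" "\<forall>\<^sub>F k in sequentially. \<bar>L k - R\<bar> < e / 4"
      using tendstoD[OF modulus, of "e / 4"] tendstoD[OF R, of "e / 4"] \<open>e > 0\<close>
      by (auto simp: dist_real_def)
    then have "\<forall>\<^sub>F k in sequentially. \<bar>\<omega> k\<bar> < e / 4 \<and> \<bar>L k - R\<bar> < e / 4 \<and> 1 \<le> k"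
      using eventually_ge_at_top[of 1] by eventually_elim auto
    \<comment> \<open>The row \<open>k\<close> is fixed before \<open>s\<close> grows, since the
      boundary term \<open>2 * K * real k / real s\<close> vanishes only for fixed \<open>k\<close>.
      Together with \<open>\<omega> k\<close> and the distances from \<open>lag_mean k s\<close> to
      \<open>L k\<close> and from \<open>L k\<close> to \<open>R\<close> there are four
      errors.\<close>
    then obtain k where k: "\<bar>\<omega> k\<bar> < e / 4" "\<bar>L k - R\<bar> < e / 4" "1 \<le> k"
      using eventually_happens'[OF sequentially_bot] by blast
    have "(\<lambda>s. 2 * K * real k / real s) \<longlonglongrightarrow> 0"
      by real_asymp
    then have "\<forall>\<^sub>F s in sequentially. \<bar>2 * K * real k / real s\<bar> < e / 4"
      using tendstoD[of "\<lambda>s. 2 * K * real k / real s" 0 _ "e / 4"] \<open>e > 0\<close> by (auto simp: dist_real_def)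
    moreover have "\<forall>\<^sub>F s in sequentially. \<bar>lag_mean k s - L k\<bar> < e / 4"
      using tendstoD[OF lag_mean_tendsto[OF k(3)], of "e / 4"] \<open>e > 0\<close> by (simp add: dist_real_def)
    ultimately have "\<forall>\<^sub>F s in sequentially. norm (column_mean s - R) < e"
      using eventually_ge_at_top[of 1]
    proof eventually_elim
      case (elim s)
      then show ?case
        using column_mean_dist[OF k(3), of s] k unfolding real_norm_def by linarith
    qed
    then show "\<exists>s0. \<forall>s\<ge>s0. norm (column_mean s - R) < e"
      by (simp add: eventually_sequentially)
  qed
  then have "(\<lambda>N. (\<Sum>s=1..N. 2 * real s * column_mean s - c s s) / (real N)\<^sup>2) \<longlonglongrightarrow> R"
    by (rule linearly_weighted_mean_tendsto[where K = K]) (auto intro: bounded)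
  then show ?thesis
    by (intro that[OF R]) (simp only: double_sum_eq)
qed

end

section \<open>Completeness of the space of integrable functions\<close>

text \<open>The Riesz-Fischer argument: a subsequence with geometrically small increments converges
  almost everywhere, and the whole sequence follows it in the mean. The hypothesis compares with one
  fixed \<open>f m\<close> because the averages are controlled by a limit in \<open>n\<close> for
  fixed \<open>m\<close>; the triangle inequality recovers the usual Cauchy property.\<close>

lemma L1_Cauchy_tendsto:
  fixes f :: "nat \<Rightarrow> 'a \<Rightarrow> real"
  assumes int [measurable]: "\<And>n. integrable M (f n)"
    and Cauchy: "\<And>e. e > 0 \<Longrightarrow> \<exists>m. \<forall>\<^sub>F n in sequentially. (LINT x|M. \<bar>f n x - f m x\<bar>) < e"
  shows "\<exists>g. tendsto_in_L1 M f g"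
proof -
  define d where "d n m = (LINT x|M. \<bar>f n x - f m x\<bar>)" for n m
  have int_diff: "integrable M (\<lambda>x. \<bar>f n x - f m x\<bar>)" for n m
    using int by auto
  have d_triangle: "d n m \<le> d n l + d m l" for n m l
  proof -
    have "d n m \<le> (LINT x|M. \<bar>f n x - f l x\<bar> + \<bar>f m x - f l x\<bar>)"
      unfolding d_def by (intro integral_mono int_diff Bochner_Integration.integrable_add) auto
    also have "\<dots> = d n l + d m l"
      unfolding d_def by (intro Bochner_Integration.integral_add int_diff)
    finally show ?thesis .
  qed
  have Cauchy': "\<exists>n0. \<forall>n\<ge>n0. \<forall>m\<ge>n0. d n m < e" if e: "e > 0" for e
  proof -
    obtain l where "\<forall>\<^sub>F n in sequentially. d n l < e / 2"
      using Cauchy[OF half_gt_zero[OF e]] unfolding d_def by blast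
    then obtain n0 where "\<And>n. n \<ge> n0 \<Longrightarrow> d n l < e / 2"
      unfolding eventually_sequentially by blast
    then have "d n m < e" if "n \<ge> n0" "m \<ge> n0" for n m
      using d_triangle[of n m l] that by (smt (verit) field_sum_of_halves)
    then show ?thesis
      by blast
  qed
  \<comment> \<open>Monotone choice puts \<open>r (Suc k)\<close> at or beyond \<open>r k\<close>,
    so the increment between the two has norm below \<open>(1/2)^k\<close>, a summable
    bound.\<close>
  have "\<exists>r. \<forall>k. (\<forall>n\<ge>r k. \<forall>m\<ge>r k. d n m < (1/2)^k) \<and> r k \<le> r (Suc k)"
  proof (rule dependent_nat_choice)
    show "\<exists>r. \<forall>n\<ge>r. \<forall>m\<ge>r. d n m < (1/2)^0"
      using Cauchy'[of 1] by simp
  next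
    fix r k
    obtain n0 where "\<forall>n\<ge>n0. \<forall>m\<ge>n0. d n m < (1/2)^Suc k"
      using Cauchy'[of "(1/2)^Suc k"] by auto
    then show "\<exists>r'. (\<forall>n\<ge>r'. \<forall>m\<ge>r'. d n m < (1/2)^Suc k) \<and> r \<le> r'"
      by (intro exI[of _ "max n0 r"]) auto
  qed
  then obtain r where r: "\<And>k n m. n \<ge> r k \<Longrightarrow> m \<ge> r k \<Longrightarrow> d n m < (1/2)^k"
    "\<And>k. r k \<le> r (Suc k)"
    by blast
  define g where "g k x = f (r (Suc k)) x - f (r k) x" for k x
  have g_int [measurable]: "integrable M (g k)" for k
    unfolding g_def using int by auto
  have norm_g: "(LINT x|M. norm (g k x)) \<le> (1/2)^k" for k
    using r(1)[of k "r (Suc k)" "r k"] r(2)[of k] by (simp add: g_def d_def)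
  have half: "summable (\<lambda>k. (1/2::real)^k)"
    by (simp add: summable_geometric)
  have sum_norms: "summable (\<lambda>k. LINT x|M. norm (g k x))"
    by (rule summable_comparison_test[OF _ half]) (use norm_g in auto)
  \<comment> \<open>The integral of the series of norms is the finite series of their integrals, so
    the series is finite almost everywhere.\<close>
  have ae: "AE x in M. summable (\<lambda>k. norm (g k x))"
  proof -
    have "(\<integral>\<^sup>+x. (\<Sum>k. ennreal (norm (g k x))) \<partial>M) = (\<Sum>k. \<integral>\<^sup>+x. ennreal (norm (g k x)) \<partial>M)"
      by (rule nn_integral_suminf) auto
    also have "\<dots> = (\<Sum>k. ennreal (LINT x|M. norm (g k x)))"
      by (intro suminf_cong nn_integral_eq_integral) (auto simp: g_int)
    also have "\<dots> \<noteq> \<infinity>"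
      using sum_norms by (simp add: suminf_ennreal2)
    finally have "AE x in M. (\<Sum>k. ennreal (norm (g k x))) \<noteq> \<infinity>"
      by (intro nn_integral_PInf_AE) auto
    then show ?thesis
      by eventually_elim (auto intro!: summable_suminf_not_top)
  qed
  \<comment> \<open>By telescoping, \<open>G x\<close> is the limit of \<open>f (r k) x\<close>
    wherever the series of norms is summable; its value on the remaining null set is
    irrelevant.\<close>
  define G where "G x = f (r 0) x + (\<Sum>k. g k x)" for x
  have G_int: "integrable M G"
    unfolding G_def by (intro Bochner_Integration.integrable_add int integrable_suminf g_int ae sum_norms)
  have partial: "(\<Sum>i<k. g i x) = f (r k) x - f (r 0) x" for k x
    unfolding g_def by (rule sum_lessThan_telescope)
  \<comment> \<open>For fixed \<open>n\<close>, dominated convergence along the subsequence makes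
    the distance to \<open>G\<close> a limit of distances within the sequence, to which the Cauchy
    bounds apply.\<close>
  have lim: "(\<lambda>k. d n (r k)) \<longlonglongrightarrow> (LINT x|M. \<bar>f n x - G x\<bar>)" for n
    unfolding d_def
  proof (rule integral_dominated_convergence)
    show "integrable M (\<lambda>x. \<bar>f n x\<bar> + \<bar>f (r 0) x\<bar> + (\<Sum>i. norm (g i x)))"
      using int g_int ae sum_norms
      by (intro Bochner_Integration.integrable_add integrable_suminf integrable_abs) auto
    show "AE x in M. (\<lambda>k. \<bar>f n x - f (r k) x\<bar>) \<longlonglongrightarrow> \<bar>f n x - G x\<bar>"
      using ae
    proof eventually_elim
      case (elim x)
      have "(\<lambda>k. f (r 0) x + (\<Sum>i<k. g i x)) \<longlonglongrightarrow> G x"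
        unfolding G_def
        by (intro tendsto_add tendsto_const summable_LIMSEQ[OF summable_norm_cancel[OF elim]])
      then have "(\<lambda>k. f (r k) x) \<longlonglongrightarrow> G x"
        unfolding partial by simp
      then show ?case
        by (intro tendsto_rabs tendsto_diff tendsto_const)
    qed
    show "AE x in M. norm \<bar>f n x - f (r k) x\<bar> \<le> \<bar>f n x\<bar> + \<bar>f (r 0) x\<bar> + (\<Sum>i. norm (g i x))" for k
      using ae
    proof eventually_elim
      case (elim x)
      have "norm (\<Sum>i<k. g i x) \<le> (\<Sum>i<k. norm (g i x))"
        by (rule norm_sum)
      also have "\<dots> \<le> (\<Sum>i. norm (g i x))"
        using elim by (intro sum_le_suminf) auto
      finally show ?case
        unfolding partial real_norm_def by linarith
    qed
  qed (use int G_int in measurable)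
  have "(\<lambda>n. LINT x|M. \<bar>f n x - G x\<bar>) \<longlonglongrightarrow> 0"
  proof (rule LIMSEQ_I)
    fix e :: real assume "e > 0"
    then obtain k where k: "(1/2)^k < e"
      using real_arch_pow_inv[of e "1/2"] by auto
    have mono: "r k \<le> r l" if "k \<le> l" for l
      using that r(2) by (induction l rule: dec_induct) (auto intro: order_trans)
    have "(LINT x|M. \<bar>f n x - G x\<bar>) \<le> (1/2)^k" if "n \<ge> r k" for n
      by (rule LIMSEQ_le_const2[OF lim]) (use r(1) that mono less_imp_le in blast)
    then show "\<exists>n0. \<forall>n\<ge>n0. norm ((LINT x|M. \<bar>f n x - G x\<bar>) - 0) < e"
      using k by (intro exI[of _ "r k"]) (auto intro!: le_less_trans[OF _ k])
  qed
  then show ?thesis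
    unfolding tendsto_in_L1_def using int G_int by blast
qed

section \<open>Mean convergence of averages with a stationary kernel\<close>

text \<open>Expanding the squared distance of two averages leaves only means of the kernel. Its
  limit in \<open>N\<close> for fixed \<open>N'\<close> is made small by the choice of
  \<open>N'\<close>, and on a finite measure space this controls the L1 distance.\<close>

lemma (in finite_measure) mean_tendsto_in_L1:
  fixes f :: "nat \<Rightarrow> 'a \<Rightarrow> real"
  assumes meas: "\<And>n. 1 \<le> n \<Longrightarrow> f n \<in> borel_measurable M"
    and bound: "\<And>n x. \<bar>f n x\<bar> \<le> B"
    and kernel: "asymptotically_stationary_kernel (\<lambda>n m. LINT x|M. f n x * f m x) K L \<omega>"
  shows "\<exists>g. tendsto_in_L1 M (\<lambda>N x. (1 / real N) * (\<Sum>n=1..N. f n x)) g"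
proof (rule L1_Cauchy_tendsto)
  interpret asymptotically_stationary_kernel "\<lambda>n m. LINT x|M. f n x * f m x" K L \<omega>
    by (rule kernel)
  define c where "c n m = (LINT x|M. f n x * f m x)" for n m
  \<comment> \<open>\<open>S 0\<close> is the zero function, and \<open>f 0\<close> enters no
    average.\<close>
  define S where "S N x = (1 / real N) * (\<Sum>n=1..N. f n x)" for N x
  define P where "P N N' = (LINT x|M. S N x * S N' x)" for N N'
  have int_ff: "integrable M (\<lambda>x. f n x * f m x)" if "1 \<le> n" "1 \<le> m" for n m
  proof (rule integrable_const_bound)
    show "AE x in M. norm (f n x * f m x) \<le> B * B"
      using bound by (intro AE_I2) (auto simp: abs_mult intro!: mult_mono intro: order_trans[OF abs_ge_zero])
  qed (use meas that in simp)
  have int_f: "integrable M (f n)" if "1 \<le> n" for n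
    by (rule integrable_const_bound[of _ B]) (use bound meas that in auto)
  have int_S: "integrable M (S N)" for N
    unfolding S_def by (intro integrable_mult_right Bochner_Integration.integrable_sum int_f) auto
  then show "integrable M (\<lambda>x. (1 / real N) * (\<Sum>n=1..N. f n x))" for N
    unfolding S_def .
  have SS: "S N x * S N' x = (1 / real N) * (1 / real N') * (\<Sum>n=1..N. \<Sum>m=1..N'. f n x * f m x)" for N N' x
    by (simp add: S_def sum_product)
  have int_SS: "integrable M (\<lambda>x. S N x * S N' x)" for N N'
    unfolding SS by (intro integrable_mult_right Bochner_Integration.integrable_sum int_ff) auto
  have P_eq: "P N N' = (1 / real N) * (1 / real N') * (\<Sum>n=1..N. \<Sum>m=1..N'. c n m)" for N N'
  proof -
    have "(LINT x|M. (\<Sum>n=1..N. \<Sum>m=1..N'. f n x * f m x))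
        = (\<Sum>n=1..N. LINT x|M. (\<Sum>m=1..N'. f n x * f m x))"
      by (intro Bochner_Integration.integral_sum Bochner_Integration.integrable_sum int_ff) auto
    also have "\<dots> = (\<Sum>n=1..N. \<Sum>m=1..N'. c n m)"
      unfolding c_def by (intro sum.cong refl Bochner_Integration.integral_sum int_ff) auto
    finally have "(LINT x|M. (\<Sum>n=1..N. \<Sum>m=1..N'. f n x * f m x)) = (\<Sum>n=1..N. \<Sum>m=1..N'. c n m)" .
    then show ?thesis
      by (simp add: P_def SS)
  qed
  obtain R where R: "L \<longlonglongrightarrow> R"
    and double: "(\<lambda>N. (\<Sum>n=1..N. \<Sum>m=1..N. c n m) / (real N)\<^sup>2) \<longlonglongrightarrow> R"
    using double_mean_limit unfolding c_def by blast
  have P_diag: "(\<lambda>N. P N N) \<longlonglongrightarrow> R"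
    using double by (simp add: P_eq power2_eq_square)
  \<comment> \<open>For fixed \<open>N'\<close> this is a mean of \<open>N'\<close> row means, so
    the limit passes through a finite sum.\<close>
  have P_row: "(\<lambda>N. P N N') \<longlonglongrightarrow> (\<Sum>m=1..N'. L m) / real N'" for N'
  proof -
    have "(\<lambda>N. (\<Sum>m=1..N'. (\<Sum>n=1..N. c n m) / real N) / real N') \<longlonglongrightarrow> (\<Sum>m=1..N'. L m) / real N'"
      unfolding c_def divide_inverse[of _ "real N'"]
      by (intro tendsto_mult tendsto_sum tendsto_const row_mean) auto
    moreover have "(\<Sum>m=1..N'. (\<Sum>n=1..N. c n m) / real N) / real N' = P N N'" for N
      unfolding P_eq by (subst sum.swap) (simp add: sum_divide_distrib)
    ultimately show ?thesis
      by simp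
  qed
  have dist2: "(LINT x|M. (S N x - S N' x)\<^sup>2) = P N N - 2 * P N N' + P N' N'" for N N'
  proof -
    have "(S N x - S N' x)\<^sup>2 = S N x * S N x - 2 * (S N x * S N' x) + S N' x * S N' x" for x
      by (simp add: power2_eq_square algebra_simps)
    then show ?thesis
      using int_SS by (simp add: P_def)
  qed
  have int_diff2: "integrable M (\<lambda>x. (S N x - S N' x)\<^sup>2)" for N N'
  proof -
    have "(S N x - S N' x)\<^sup>2 = S N x * S N x - 2 * (S N x * S N' x) + S N' x * S N' x" for x
      by (simp add: power2_eq_square algebra_simps)
    then show ?thesis
      using int_SS by simp
  qed
  show "\<exists>N'. \<forall>\<^sub>F N in sequentially.
      (LINT x|M. \<bar>(1 / real N) * (\<Sum>n=1..N. f n x) - (1 / real N') * (\<Sum>n=1..N'. f n x)\<bar>) < e"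
    if "e > 0" for e
  proof -
    define \<mu> where "\<mu> = measure M (space M)"
    \<comment> \<open>The 1 in the denominator covers a space of measure 0 and makes
      \<open>\<delta> * \<mu> < e\<close> strict. Once the squared distance is below
      \<open>e * \<delta>\<close>, its quotient by \<open>2 * \<delta>\<close> is below
      \<open>e / 2\<close>.\<close>
    define \<delta> where "\<delta> = e / (\<mu> + 1)"
    have \<mu>: "\<mu> \<ge> 0"
      by (simp add: \<mu>_def)
    have \<delta>: "\<delta> > 0" "\<delta> * \<mu> < e"
      using that \<mu> by (auto simp: \<delta>_def field_simps)
    have "(\<lambda>N'. R - 2 * ((\<Sum>m=1..N'. L m) / real N') + P N' N') \<longlonglongrightarrow> R - 2 * R + R"
      by (intro tendsto_intros cesaro_mean_tendsto R P_diag)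
    then have "\<forall>\<^sub>F N' in sequentially. R - 2 * ((\<Sum>m=1..N'. L m) / real N') + P N' N' < e * \<delta>"
      by (rule order_tendstoD) (use that \<delta> in simp)
    then obtain N' where N': "R - 2 * ((\<Sum>m=1..N'. L m) / real N') + P N' N' < e * \<delta>"
      using eventually_happens'[OF sequentially_bot] by blast
    have "(\<lambda>N. P N N - 2 * P N N' + P N' N') \<longlonglongrightarrow> R - 2 * ((\<Sum>m=1..N'. L m) / real N') + P N' N'"
      by (intro tendsto_intros P_row P_diag)
    then have "\<forall>\<^sub>F N in sequentially. P N N - 2 * P N N' + P N' N' < e * \<delta>"
      using N' by (rule order_tendstoD)
    then have "\<forall>\<^sub>F N in sequentially. (LINT x|M. \<bar>S N x - S N' x\<bar>) < e"
    proof eventually_elim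
      case (elim N)
      \<comment> \<open>AM-GM in place of the Cauchy-Schwarz inequality.\<close>
      have amgm: "\<bar>t\<bar> \<le> t\<^sup>2 / (2 * \<delta>) + \<delta> / 2" for t :: real
      proof -
        have "0 \<le> (\<bar>t\<bar> - \<delta>)\<^sup>2"
          by simp
        then show ?thesis
          using \<delta>(1) by (simp add: field_simps power2_eq_square)
      qed
      have "(LINT x|M. \<bar>S N x - S N' x\<bar>) \<le> (LINT x|M. (S N x - S N' x)\<^sup>2 / (2 * \<delta>) + \<delta> / 2)"
        by (intro integral_mono amgm Bochner_Integration.integrable_add integrable_divide int_diff2
            integrable_abs Bochner_Integration.integrable_diff int_S) auto
      also have "\<dots> = (P N N - 2 * P N N' + P N' N') / (2 * \<delta>) + \<delta> * \<mu> / 2"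
        using int_diff2[of N N'] by (simp add: dist2 \<mu>_def)
      also have "(P N N - 2 * P N N' + P N' N') / (2 * \<delta>) < e / 2"
        using elim \<delta>(1) by (simp add: field_simps)
      finally show ?case
        using \<delta>(2) by linarith
    qed
    then show ?thesis
      by (auto simp: S_def)
  qed
qed

section \<open>Application to compactly supported \<open>b\<close> and the sequence
  \<open>U\<close>\<close>

lemma Cc_bounded:
  assumes "b \<in> Cc"
  obtains B where "\<And>x. \<bar>b x\<bar> \<le> B"
proof -
  let ?C = "closure {x. b x \<noteq> 0}"
  have "compact (b ` ?C)"
    using assms by (auto simp: Cc_def intro!: compact_continuous_image elim: continuous_on_subset)
  then obtain B where B: "\<And>y. y \<in> b ` ?C \<Longrightarrow> norm y \<le> B"
    using compact_imp_bounded bounded_iff by metis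
  \<comment> \<open>Off its support \<open>b\<close> is 0; if the support is empty, \<open>B\<close>
    is unconstrained and may be negative.\<close>
  have "\<bar>b x\<bar> \<le> max B 0" for x
    using B[of "b x"] closure_subset[of "{x. b x \<noteq> 0}"] by (cases "b x = 0") force+
  then show ?thesis
    by (rule that)
qed

theorem theorem4p3:
  fixes Q :: "(real^'m) set" and U :: "nat \<Rightarrow> real^'m \<Rightarrow> real^'d"
  assumes "Q \<in> sets lebesgue" and "emeasure lebesgue Q < \<infinity>"
    and "\<And>n. n \<ge> 1 \<Longrightarrow> U n \<in> borel_measurable (lebesgue_on Q)"
    and "weakly_asymptotically_stationary Q U"
  shows "weakly_S_convergent Q U \<and>
    (\<forall>b\<in>Cc. \<exists>bU :: real^'m \<Rightarrow> real.
       tendsto_in_L1 (lebesgue_on Q) (\<lambda>N y. (1 / real N) * (\<Sum>n=1..N. b (U n y))) bU)"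
proof -
  interpret finite_measure "lebesgue_on Q"
    using assms(1,2) by (intro finite_measure_lebesgue_on fmeasurableI) auto
  have ex_kernel: "\<exists>B K \<omega>. (\<forall>x. \<bar>b x\<bar> \<le> B) \<and> asymptotically_stationary_kernel (corr Q b U) K
      (\<lambda>m. lim (\<lambda>N. (1 / real N) * (\<Sum>n=1..N. corr Q b U n m))) \<omega>"
    and meas_bU: "\<And>n. 1 \<le> n \<Longrightarrow> (\<lambda>y. b (U n y)) \<in> borel_measurable (lebesgue_on Q)"
    if b: "b \<in> Cc" for b :: "real^'d \<Rightarrow> real"
  proof -
    obtain B where B: "\<And>x. \<bar>b x\<bar> \<le> B"
      using Cc_bounded[OF b] by blast
    have "b \<in> borel_measurable borel"
      using b by (auto simp: Cc_def intro: borel_measurable_continuous_onI)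
    then show meas: "(\<lambda>y. b (U n y)) \<in> borel_measurable (lebesgue_on Q)" if "1 \<le> n" for n
      using measurable_compose[OF assms(3)[OF that]] by blast
    have bb: "\<bar>b x * b y\<bar> \<le> B * B" for x y
      using B[of x] B[of y] by (auto simp: abs_mult intro!: mult_mono)
    have int: "integrable (lebesgue_on Q) (\<lambda>y. b (U n y) * b (U m y))" if "1 \<le> n" "1 \<le> m" for n m
      by (rule integrable_const_bound[of _ "B * B"]) (use bb meas that in auto)
    \<comment> \<open>The right-hand side becomes the \<open>K\<close> of the kernel; it is finite
      because \<open>Q\<close> has finite measure.\<close>
    have bounded: "\<bar>corr Q b U n m\<bar> \<le> B * B * measure (lebesgue_on Q) (space (lebesgue_on Q))"
      if "1 \<le> n" "1 \<le> m" for n m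
    proof -
      have "\<bar>corr Q b U n m\<bar> \<le> (LINT y|lebesgue_on Q. \<bar>b (U n y) * b (U m y)\<bar>)"
        unfolding corr_def by (rule integral_abs_bound)
      also have "\<dots> \<le> (LINT y|lebesgue_on Q. B * B)"
        by (intro integral_mono integrable_abs int that bb integrable_const)
      finally show ?thesis
        by (simp add: mult_ac)
    qed
    have stationary: "(\<forall>m\<ge>1. convergent (\<lambda>N. (1 / real N) * (\<Sum>n=1..N. corr Q b U n m))) \<and>
        (\<exists>\<omega> :: nat \<Rightarrow> real. \<omega> \<longlonglongrightarrow> 0 \<and>
          (\<forall>k i j n. 1 \<le> k \<and> k \<le> i \<and> i \<le> j \<longrightarrow>
            \<bar>LINT y|lebesgue_on Q. b (U i y) * b (U j y) - b (U (i + n) y) * b (U (j + n) y)\<bar> \<le> \<omega> k))"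
      by (rule bspec[OF assms(4)[unfolded weakly_asymptotically_stationary_def] b])
    then obtain \<omega> :: "nat \<Rightarrow> real" where \<omega>: "\<omega> \<longlonglongrightarrow> 0"
      "\<forall>k i j n. 1 \<le> k \<and> k \<le> i \<and> i \<le> j \<longrightarrow>
         \<bar>LINT y|lebesgue_on Q. b (U i y) * b (U j y) - b (U (i + n) y) * b (U (j + n) y)\<bar> \<le> \<omega> k"
      by (elim conjE exE)
    have "asymptotically_stationary_kernel (corr Q b U)
        (B * B * measure (lebesgue_on Q) (space (lebesgue_on Q)))
        (\<lambda>m. lim (\<lambda>N. (1 / real N) * (\<Sum>n=1..N. corr Q b U n m))) \<omega>"
    proof
      fix n m
      show "corr Q b U n m = corr Q b U m n"
        unfolding corr_def by (intro Bochner_Integration.integral_cong refl mult.commute)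
    next
      fix k :: nat assume "1 \<le> k"
      then have "convergent (\<lambda>N. (1 / real N) * (\<Sum>n=1..N. corr Q b U n k))"
        using stationary by blast
      then show "(\<lambda>N. (\<Sum>n=1..N. corr Q b U n k) / real N)
          \<longlonglongrightarrow> lim (\<lambda>N. (1 / real N) * (\<Sum>n=1..N. corr Q b U n k))"
        unfolding convergent_LIMSEQ_iff by simp
    next
      \<comment> \<open>Stationarity bounds the integral of a difference. Both products are
        integrable, as all indices are at least 1, so this is a difference of correlations.\<close>
      fix k i j n :: nat assume "1 \<le> k" "k \<le> i" "i \<le> j"
      then show "\<bar>corr Q b U i j - corr Q b U (i + n) (j + n)\<bar> \<le> \<omega> k"
        using \<omega>(2)[rule_format, of k i j n] by (simp add: corr_def int)
    qed (use bounded \<omega>(1) in auto)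
    then show "\<exists>B K \<omega>. (\<forall>x. \<bar>b x\<bar> \<le> B) \<and> asymptotically_stationary_kernel (corr Q b U) K
        (\<lambda>m. lim (\<lambda>N. (1 / real N) * (\<Sum>n=1..N. corr Q b U n m))) \<omega>"
      using B by blast
  qed
  have "weakly_S_convergent Q U"
    unfolding weakly_S_convergent_def
  proof (rule ballI)
    fix b :: "real^'d \<Rightarrow> real" assume b: "b \<in> Cc"
    define L where "L m = lim (\<lambda>N. (1 / real N) * (\<Sum>n=1..N. corr Q b U n m))" for m
    obtain K \<omega> where "asymptotically_stationary_kernel (corr Q b U) K L \<omega>"
      using ex_kernel[OF b] unfolding L_def by blast
    then obtain R where "L \<longlonglongrightarrow> R"
      and double: "(\<lambda>N. (\<Sum>n=1..N. \<Sum>m=1..N. corr Q b U n m) / (real N)\<^sup>2) \<longlonglongrightarrow> R"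
      using asymptotically_stationary_kernel.double_mean_limit by blast
    \<comment> \<open>Convergence of \<open>L\<close> passes to its Cesaro means, so the iterated
      limit is the same \<open>R\<close> as the limit of the double means.\<close>
    then have iterated: "(\<lambda>M. (1 / real M) * (\<Sum>m=1..M. L m)) \<longlonglongrightarrow> R"
      using cesaro_mean_tendsto by simp
    have double': "(\<lambda>N. (1 / (real N)\<^sup>2) * (\<Sum>n=1..N. \<Sum>m=1..N. corr Q b U n m)) \<longlonglongrightarrow> R"
      using double by simp
    have rows: "\<forall>m\<ge>1. convergent (\<lambda>N. (1 / real N) * (\<Sum>n=1..N. corr Q b U n m))"
      using assms(4) b unfolding weakly_asymptotically_stationary_def by blast
    show "(\<forall>m\<ge>1. convergent (\<lambda>N. (1 / real N) * (\<Sum>n=1..N. corr Q b U n m))) \<and>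
        convergent (\<lambda>N. (1 / (real N)\<^sup>2) * (\<Sum>n=1..N. \<Sum>m=1..N. corr Q b U n m)) \<and>
        convergent (\<lambda>M. (1 / real M) *
          (\<Sum>m=1..M. lim (\<lambda>N. (1 / real N) * (\<Sum>n=1..N. corr Q b U n m)))) \<and>
        lim (\<lambda>N. (1 / (real N)\<^sup>2) * (\<Sum>n=1..N. \<Sum>m=1..N. corr Q b U n m)) =
        lim (\<lambda>M. (1 / real M) *
          (\<Sum>m=1..M. lim (\<lambda>N. (1 / real N) * (\<Sum>n=1..N. corr Q b U n m))))"
      unfolding L_def[symmetric]
      by (intro conjI rows convergentI[OF double'] convergentI[OF iterated]
          trans[OF limI[OF double'] limI[OF iterated, symmetric]])
  qed
  moreover have "\<exists>bU. tendsto_in_L1 (lebesgue_on Q) (\<lambda>N y. (1 / real N) * (\<Sum>n=1..N. b (U n y))) bU"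
    if b: "b \<in> Cc" for b :: "real^'d \<Rightarrow> real"
  proof -
    obtain B K \<omega> where B: "\<forall>x. \<bar>b x\<bar> \<le> B"
      and kernel: "asymptotically_stationary_kernel (corr Q b U) K
        (\<lambda>m. lim (\<lambda>N. (1 / real N) * (\<Sum>n=1..N. corr Q b U n m))) \<omega>"
      using ex_kernel[OF b] by (elim exE conjE)
    have "corr Q b U = (\<lambda>n m. LINT y|lebesgue_on Q. b (U n y) * b (U m y))"
      by (intro ext corr_def)
    with kernel have "asymptotically_stationary_kernel
        (\<lambda>n m. LINT y|lebesgue_on Q. b (U n y) * b (U m y)) K
        (\<lambda>m. lim (\<lambda>N. (1 / real N) * (\<Sum>n=1..N. corr Q b U n m))) \<omega>"
      by (rule back_subst[where P = "\<lambda>c. asymptotically_stationary_kernel c K _ \<omega>"])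
    then show ?thesis
      using mean_tendsto_in_L1[where f = "\<lambda>n y. b (U n y)" and B = B, OF meas_bU[OF b]] B by blast
  qed
  ultimately show ?thesis
    by blast
qed

end
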